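(* There exists a locally checkable problem whose round complexity in $n$-node graphs, in the LOCAL model, is $\Theta(\log^\sharp n)$.
   Context: Notation. $\log^\star n$ is the number of times $\log_2$ must be applied to $n$ until the result is at most $1$. The function $\log^\sharp:\mathbb{N}\to\mathbb{N}$ is defined by $\log^\sharp(n)=0$ if $n\le 1$ and $\log^\sharp(n)=1+\log^\sharp(\log^\star n)$ if $n>1$. LOCAL model. The network is a simple connected graph $G=(V,E)$ with $n\ge 1$ nodes. Each node $v$ has an identifier $\mathrm{id}(v)\in[0,N]$, unique in the network, where $N$ is an upper bound on $n$ that is polynomial in $n$; $N$ may be given to the nodes. Initially a node knows only its identifier, its degree and its input label (and $N$), and nothing else about the graph. Computation proceeds in synchronous rounds, all nodes starting at the same round; in each round every node performs arbitrary local computation, sends a message of arbitrary size to each neighbor, and receives its neighbors' messages. Each node eventually outputs a label. The round complexity of a (deterministic) algorithm is the function of $n$ giving the maximum, over all $n$-node graphs (and all identifier and input assignments), of the number of rounds until all nodes have output. Locally checkable problem. A pair $(L,\varphi)$ where $L$ is a finite set of labels and $\varphi$ is a Boolean predicate on $L$-labeled balls of radius $r$ (for some fixed integer $r\ge 0$) in arbitrary graphs (no bound on the degrees); the ball of radius $r$ centered at $v$ is the subgraph induced by the nodes at distance at most $r$ from $v$. Input labels are allowed: $L=L_{in}\times L_{out}$, each node $v$ receives an arbitrary $\ell_{in}(v)\in L_{in}$ and must output $\ell_{out}(v)\in L_{out}$. An algorithm solves the problem if for every input graph and every input labeling the produced labeling is such that the labeled ball of radius $r$ around every node satisfies $\varphi$.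 A problem has round complexity $\Theta(t(n))$ if some algorithm solves it in $O(t(n))$ rounds and every algorithm solving it has round complexity $\Omega(t(n))$. *)

theory Defs
  imports Complex_Main "HOL-Library.Landau_Symbols"
begin

section \<open>The functions log-star and log-sharp\<close>

definition log_star :: "nat \<Rightarrow> nat" where
  "log_star n = (LEAST k. (log 2 ^^ k) (real n) \<le> 1)"

lemma log2_le_minus_one:
  fixes x :: real
  assumes "x \<ge> 2"
  shows "log 2 x \<le> x - 1"
proof -
  have "ln x = ln 2 + ln (x / 2)"
    using assms by (simp add: ln_div)
  also have "\<dots> \<le> ln 2 + (x / 2 - 1)"
    using ln_le_minus_one[of "x / 2"] assms by simp
  also have "\<dots> \<le> ln 2 + (x - 2) * ln 2"
  proof -
    have "(x - 2) * (1 / 2) \<le> (x - 2) * ln (2::real)"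
      using assms ln_le_minus_one[of "1 / 2 :: real"] by (intro mult_left_mono) (auto simp: ln_div)
    then show ?thesis by simp
  qed
  finally have "ln x \<le> (x - 1) * ln 2"
    by (simp add: algebra_simps)
  then show ?thesis
    by (simp add: log_def divide_simps)
qed

lemma log2_iterate_le_one:
  fixes x :: real
  assumes "x \<le> real m + 2"
  shows "\<exists>k \<le> Suc m. (log 2 ^^ k) x \<le> 1"
  using assms
proof (induction m arbitrary: x)
  case 0
  show ?case
  proof (cases "x \<le> 1")
    case True
    then show ?thesis by (intro exI[of _ 0]) simp
  next
    case False
    then have "log 2 x \<le> 1" using 0 by simp
    then show ?thesis by (intro exI[of _ 1]) simp
  qed
next
  case (Suc m)
  show ?case
  proof (cases "x \<le> real m + 2")
    case True
    then show ?thesis using Suc.IH le_SucI by blast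
  next
    case False
    then have "log 2 x \<le> real m + 2"
      using log2_le_minus_one[of x] Suc.prems by simp
    then obtain k where "k \<le> Suc m" "(log 2 ^^ k) (log 2 x) \<le> 1"
      using Suc.IH by blast
    then show ?thesis
      by (intro exI[of _ "Suc k"]) (simp add: funpow_Suc_right del: funpow.simps)
  qed
qed

lemma log_star_less:
  assumes "n > 1"
  shows "log_star n < n"
proof -
  have "real n \<le> real (n - 2) + 2" using assms by simp
  then obtain k where k: "k \<le> Suc (n - 2)" "(log 2 ^^ k) (real n) \<le> 1"
    using log2_iterate_le_one by blast
  have "log_star n \<le> k"
    unfolding log_star_def by (rule Least_le) (rule k(2))
  then show ?thesis using k(1) assms by simp
qed

function log_sharp :: "nat \<Rightarrow> nat" where
  "log_sharp n = (if n \<le> 1 then 0 else 1 + log_sharp (log_star n))"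
  by auto
termination
  by (relation "measure id") (auto simp: log_star_less)

declare log_sharp.simps [simp del]


section \<open>Networks\<close>

text \<open>
  The nodes of an \<open>n\<close>-node network are \<open>0, \<dots>, n - 1\<close>; these names are never visible to
  the nodes. The list \<open>ports I ! v\<close> enumerates the neighbors of \<open>v\<close>: as a node initially
  knows only its degree, it can address its neighbors only by their position in this list.
  The order is arbitrary, and distinct nodes may use unrelated orders.
\<close>

record network =
  ports :: "nat list list"
  id_bound :: nat
  idents :: "nat list"
  inputs :: "nat list"

definition num_nodes :: "network \<Rightarrow> nat" where
  "num_nodes I = length (ports I)"

definition edges :: "network \<Rightarrow> (nat \<times> nat) set" where
  "edges I = {(v, u). v < num_nodes I \<and> u \<in> set (ports I ! v)}"

definition simple_connected_graph :: "nat set \<Rightarrow> (nat \<times> nat) set \<Rightarrow> bool" where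
  "simple_connected_graph V E \<longleftrightarrow>
     finite V \<and> V \<noteq> {} \<and> E \<subseteq> V \<times> V \<and> sym E \<and> irrefl E \<and>
     (\<forall>u\<in>V. \<forall>v\<in>V. (u, v) \<in> E\<^sup>*)"

text \<open>
  The set \<open>R n\<close> contains the bounds \<open>N\<close> that may be in force in an \<open>n\<close>-node network.
  A singleton \<open>R n\<close> makes \<open>N\<close> a fixed function of \<open>n\<close>; with \<open>R n = {n..p n}\<close>, the bound
  may be any number between \<open>n\<close> and \<open>p n\<close>.
\<close>

definition polynomial_bounds :: "(nat \<Rightarrow> nat set) \<Rightarrow> bool" where
  "polynomial_bounds R \<longleftrightarrow>
     (\<forall>n\<ge>1. R n \<noteq> {} \<and> (\<forall>N\<in>R n. n \<le> N)) \<and>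
     (\<exists>c k. \<forall>n\<ge>1. \<forall>N\<in>R n. N \<le> c * n ^ k)"

definition networks :: "(nat \<Rightarrow> nat set) \<Rightarrow> nat set \<Rightarrow> nat \<Rightarrow> network set" where
  "networks R Lin n =
     {I. num_nodes I = n \<and>
         (\<forall>v<n. distinct (ports I ! v)) \<and>
         simple_connected_graph {..<n} (edges I) \<and>
         id_bound I \<in> R n \<and>
         length (idents I) = n \<and> distinct (idents I) \<and> set (idents I) \<subseteq> {0..id_bound I} \<and>
         length (inputs I) = n \<and> set (inputs I) \<subseteq> Lin}"


section \<open>Algorithms in the LOCAL model\<close>

text \<open>
  The arguments of \<open>init\<close> are \<open>N\<close>, the identifier, the degree and the input label of the node.
  The message sent to the neighbor at position \<open>i\<close> is \<open>send s i\<close>; the list passed to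
  \<open>receive\<close> contains the incoming messages in the order of the node's own neighbor list.
\<close>

record ('s, 'm) local_algorithm =
  init :: "nat \<Rightarrow> nat \<Rightarrow> nat \<Rightarrow> nat \<Rightarrow> 's"
  send :: "'s \<Rightarrow> nat \<Rightarrow> 'm"
  receive :: "'s \<Rightarrow> 'm list \<Rightarrow> 's"
  announce :: "'s \<Rightarrow> nat option"

text \<open>
  The initial knowledge of a node ranges over a countable set, and in each round a node receives
  a finite list of messages. So for any types of states and messages, only countably many
  states and messages can ever occur, and taking both to be natural numbers is no restriction.
\<close>

type_synonym algorithm = "(nat, nat) local_algorithm"

definition port_to :: "network \<Rightarrow> nat \<Rightarrow> nat \<Rightarrow> nat" where
  "port_to I u v = (THE i. i < length (ports I ! u) \<and> ports I ! u ! i = v)"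

primrec node_state :: "('s, 'm) local_algorithm \<Rightarrow> network \<Rightarrow> nat \<Rightarrow> nat \<Rightarrow> 's" where
  "node_state A I 0 v =
     init A (id_bound I) (idents I ! v) (length (ports I ! v)) (inputs I ! v)"
| "node_state A I (Suc t) v =
     receive A (node_state A I t v)
       (map (\<lambda>u. send A (node_state A I t u) (port_to I u v)) (ports I ! v))"

text \<open>
  The label output by a node is the first one that it announces. A node that has output its
  label continues to take part in the communication.
\<close>

definition has_output_by :: "('s, 'm) local_algorithm \<Rightarrow> network \<Rightarrow> nat \<Rightarrow> nat \<Rightarrow> bool" where
  "has_output_by A I t v \<longleftrightarrow> (\<exists>s\<le>t. announce A (node_state A I s v) \<noteq> None)"

definition final_output :: "('s, 'm) local_algorithm \<Rightarrow> network \<Rightarrow> nat \<Rightarrow> nat" where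
  "final_output A I v =
     the (announce A (node_state A I (LEAST s. announce A (node_state A I s v) \<noteq> None) v))"

definition terminates :: "('s, 'm) local_algorithm \<Rightarrow> network \<Rightarrow> bool" where
  "terminates A I \<longleftrightarrow> (\<exists>t. \<forall>v<num_nodes I. has_output_by A I t v)"

definition rounds :: "('s, 'm) local_algorithm \<Rightarrow> network \<Rightarrow> nat" where
  "rounds A I = (LEAST t. \<forall>v<num_nodes I. has_output_by A I t v)"


section \<open>Locally checkable problems\<close>

text \<open>The label of a node is the pair of its input label and its output label.\<close>

record labeled_ball =
  ball_nodes :: "nat set"
  ball_edges :: "(nat \<times> nat) set"
  ball_center :: nat
  ball_label :: "nat \<Rightarrow> nat \<times> nat"

definition ball_around :: "(nat \<times> nat) set \<Rightarrow> nat \<Rightarrow> nat \<Rightarrow> nat set" where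
  "ball_around E r v = {u. \<exists>k\<le>r. (v, u) \<in> E ^^ k}"

definition labeled_ball_around ::
    "(nat \<times> nat) set \<Rightarrow> (nat \<Rightarrow> nat \<times> nat) \<Rightarrow> nat \<Rightarrow> nat \<Rightarrow> labeled_ball" where
  "labeled_ball_around E l r v =
     \<lparr>ball_nodes = ball_around E r v,
      ball_edges = Restr E (ball_around E r v),
      ball_center = v,
      ball_label = l\<rparr>"

definition ball_isomorphic :: "labeled_ball \<Rightarrow> labeled_ball \<Rightarrow> bool" where
  "ball_isomorphic b b' \<longleftrightarrow>
     (\<exists>f. bij_betw f (ball_nodes b) (ball_nodes b') \<and>
          f (ball_center b) = ball_center b' \<and>
          (\<forall>u\<in>ball_nodes b. \<forall>w\<in>ball_nodes b.
             (u, w) \<in> ball_edges b \<longleftrightarrow> (f u, f w) \<in> ball_edges b') \<and>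
          (\<forall>u\<in>ball_nodes b. ball_label b u = ball_label b' (f u)))"

record problem =
  in_labels :: "nat set"
  out_labels :: "nat set"
  radius :: nat
  accepts :: "labeled_ball \<Rightarrow> bool"

text \<open>
  Invariance under isomorphism makes \<open>accepts\<close> a predicate on labeled balls rather than on
  their representations: it can depend neither on the names of the nodes (hence not on
  identifiers or port orders) nor on values of \<open>ball_label\<close> outside the ball.
\<close>

definition locally_checkable :: "problem \<Rightarrow> bool" where
  "locally_checkable P \<longleftrightarrow>
     finite (in_labels P) \<and> in_labels P \<noteq> {} \<and> finite (out_labels P) \<and>
     (\<forall>b b'. ball_isomorphic b b' \<longrightarrow> accepts P b = accepts P b')"

definition solves :: "('s, 'm) local_algorithm \<Rightarrow> problem \<Rightarrow> (nat \<Rightarrow> nat set) \<Rightarrow> bool" where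
  "solves A P R \<longleftrightarrow>
     (\<forall>n\<ge>1. \<forall>I\<in>networks R (in_labels P) n.
        terminates A I \<and>
        (\<forall>v<n. final_output A I v \<in> out_labels P) \<and>
        (\<forall>v<n. accepts P
           (labeled_ball_around (edges I) (\<lambda>u. (inputs I ! u, final_output A I u))
              (radius P) v)))"

definition round_complexity ::
    "('s, 'm) local_algorithm \<Rightarrow> problem \<Rightarrow> (nat \<Rightarrow> nat set) \<Rightarrow> nat \<Rightarrow> nat" where
  "round_complexity A P R n = Max (rounds A ` networks R (in_labels P) n)"

text \<open>The maximum is taken over a finite set.\<close>

lemma finite_networks:
  assumes "polynomial_bounds R" "finite Lin" "n \<ge> 1"
  shows "finite (networks R Lin n)"
proof -
  obtain c k where ck: "\<forall>n\<ge>1. \<forall>N\<in>R n. N \<le> c * n ^ k"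
    using assms(1) unfolding polynomial_bounds_def by blast
  define M where "M = c * n ^ k"
  define Q where "Q = {xs. set xs \<subseteq> {..<n} \<and> length xs \<le> n}"
  define S where "S = {ps. set ps \<subseteq> Q \<and> length ps = n} \<times> {..M} \<times>
    {is. set is \<subseteq> {0..M} \<and> length is = n} \<times> {xs. set xs \<subseteq> Lin \<and> length xs = n}"
  have "finite Q"
    unfolding Q_def by (intro finite_lists_length_le) simp
  then have "finite S"
    unfolding S_def using assms(2)
    by (intro finite_cartesian_product finite_lists_length_eq) simp_all
  moreover have "networks R Lin n \<subseteq>
    (\<lambda>(ps, N, is, xs). \<lparr>ports = ps, id_bound = N, idents = is, inputs = xs\<rparr>) ` S"
  proof
    fix I assume I: "I \<in> networks R Lin n"
    have M: "id_bound I \<le> M"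
      using I ck assms(3) unfolding networks_def M_def by blast
    have len: "length (ports I) = n"
      using I unfolding networks_def num_nodes_def by simp
    have "p \<in> Q" if p: "p \<in> set (ports I)" for p
    proof -
      obtain v where v: "v < n" "p = ports I ! v"
        using p len by (auto simp: in_set_conv_nth)
      have "edges I \<subseteq> {..<n} \<times> {..<n}"
        using I unfolding networks_def simple_connected_graph_def by blast
      then have sub: "set p \<subseteq> {..<n}"
        using v len unfolding edges_def num_nodes_def by blast
      moreover have "distinct p" using I v unfolding networks_def by blast
      ultimately have "length p \<le> n"
        using card_mono[of "{..<n}" "set p"] by (simp add: distinct_card)
      with sub show ?thesis unfolding Q_def by simp
    qed
    then have "set (ports I) \<subseteq> Q" by blast
    moreover have "set (idents I) \<subseteq> {0..M}"
      using I M unfolding networks_def by fastforce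
    moreover have "length (idents I) = n" "length (inputs I) = n" "set (inputs I) \<subseteq> Lin"
      using I unfolding networks_def by blast+
    ultimately have "(ports I, id_bound I, idents I, inputs I) \<in> S"
      using M len unfolding S_def by simp
    moreover have "I = (\<lambda>(ps, N, is, xs).
        \<lparr>ports = ps, id_bound = N, idents = is, inputs = xs\<rparr>)
        (ports I, id_bound I, idents I, inputs I)"
      by simp
    ultimately show "I \<in> (\<lambda>(ps, N, is, xs).
        \<lparr>ports = ps, id_bound = N, idents = is, inputs = xs\<rparr>) ` S"
      by blast
  qed
  ultimately show ?thesis
    using finite_subset[OF _ finite_imageI] by metis
qed

definition has_round_complexity_Theta ::
    "problem \<Rightarrow> (nat \<Rightarrow> nat set) \<Rightarrow> (nat \<Rightarrow> nat) \<Rightarrow> bool" where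
  "has_round_complexity_Theta P R t \<longleftrightarrow>
     (\<exists>A :: algorithm. solves A P R \<and>
        (\<lambda>n. real (round_complexity A P R n)) \<in> O(\<lambda>n. real (t n))) \<and>
     (\<forall>A :: algorithm. solves A P R \<longrightarrow>
        (\<lambda>n. real (round_complexity A P R n)) \<in> \<Omega>(\<lambda>n. real (t n)))"

end

theory Submission
  imports Defs "HOL-Library.Countable"
begin

text \<open>
  Call a neighbor \<open>u\<close> of \<open>v\<close> lower if \<open>3 \<le> deg u \<le> log_star (deg v)\<close>. The problem asks every node
  to output 1 iff its input is 1 or some lower neighbor outputs 1. A descending chain of lower
  neighbors starting at \<open>v\<close> has length at most \<open>log_sharp (deg v)\<close>, so that many rounds suffice on
  every graph. Conversely, in a caterpillar whose spine degrees grow like iterated towers of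
  twos, the spine is a descending chain of length about \<open>log_sharp n\<close>, and the input bit at its
  low end must be copied to its high end. The threshold 3 keeps the leaves out of this chain.
\<close>

section \<open>Towers of twos\<close>

primrec tower :: "nat \<Rightarrow> nat" where
  "tower 0 = 1"
| "tower (Suc m) = 2 ^ tower m"

lemma double_le_power: "2 * a \<le> 2 ^ a" for a :: nat
proof (induction a)
  case (Suc a)
  have "(1::nat) \<le> 2 ^ a" by simp
  with Suc show ?case by (cases a) auto
qed simp

lemma less_tower: "m < tower m"
proof (induction m)
  case (Suc m)
  have "tower m < 2 ^ tower m" by (rule less_exp)
  with Suc have "Suc m < 2 ^ tower m" by linarith
  then show ?case by simp
qed simp

text \<open>Peeling off the innermost logarithm reduces the claim for \<open>Suc m\<close> to
  \<open>log 2 x \<le> real (tower m)\<close>, which exponentiates to the next tower. The case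
  \<open>x \<le> 1\<close> is split off so that \<open>log\<close> is evaluated only at positive
  arguments.\<close>

lemma log2_iterates_le_one_iff:
  "(\<exists>k\<le>m. (log 2 ^^ k) x \<le> 1) \<longleftrightarrow> x \<le> real (tower m)"
proof (induction m arbitrary: x)
  case (Suc m)
  have "(\<exists>k\<le>Suc m. (log 2 ^^ k) x \<le> 1) \<longleftrightarrow> x \<le> 1 \<or> (\<exists>k\<le>m. (log 2 ^^ Suc k) x \<le> 1)"
    by (metis (no_types, lifting) Suc_le_mono funpow_0 not0_implies_Suc zero_le)
  also have "\<dots> \<longleftrightarrow> x \<le> 1 \<or> log 2 x \<le> real (tower m)"
    using Suc.IH[of "log 2 x"] by (simp only: funpow_Suc_right o_apply)
  also have "\<dots> \<longleftrightarrow> x \<le> real (tower (Suc m))"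
  proof (cases "x \<le> 1")
    case True
    have "(1::real) \<le> 2 ^ tower m" by simp
    with True have "x \<le> 2 ^ tower m" by linarith
    with True show ?thesis by simp
  next
    case False
    then show ?thesis by (simp add: log_le_iff powr_realpow)
  qed
  finally show ?case .
qed simp

text \<open>A Galois connection between \<open>log_star\<close> and \<open>tower\<close>. It lets
  later arguments compare natural numbers with towers instead of handling real logarithms.\<close>

lemma log_star_le_iff: "log_star n \<le> m \<longleftrightarrow> n \<le> tower m"
proof
  have "\<exists>k. (log 2 ^^ k) (real n) \<le> 1"
    using log2_iterate_le_one[of "real n" n] by auto
  then have "(log 2 ^^ log_star n) (real n) \<le> 1"
    unfolding log_star_def by (rule LeastI_ex)
  then show "n \<le> tower m" if "log_star n \<le> m"
    using log2_iterates_le_one_iff[of m "real n"] that by auto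
next
  assume "n \<le> tower m"
  then obtain k where "k \<le> m" "(log 2 ^^ k) (real n) \<le> 1"
    using log2_iterates_le_one_iff[of m "real n"] by auto
  then show "log_star n \<le> m"
    unfolding log_star_def by (meson Least_le le_trans)
qed

lemma log_star_mono: "m \<le> n \<Longrightarrow> log_star m \<le> log_star n"
  by (meson log_star_le_iff le_trans order_refl)

lemma log_sharp_mono: "m \<le> n \<Longrightarrow> log_sharp m \<le> log_sharp n"
proof (induction n arbitrary: m rule: less_induct)
  case (less n)
  show ?case
  proof (cases "m \<le> 1")
    case False
    then have "log_sharp (log_star m) \<le> log_sharp (log_star n)"
      using less by (simp add: log_star_less log_star_mono)
    then show ?thesis
      using False less.prems by (simp add: log_sharp.simps[of m] log_sharp.simps[of n])
  qed (simp add: log_sharp.simps[of m])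
qed

text \<open>The values are 0, 1, 2, 4, 65536 and so on; after the first, \<open>log_star\<close>
  maps each one to its predecessor. They name the spine nodes of the caterpillar and also set the
  scale of their degrees.\<close>

definition spine :: "nat \<Rightarrow> nat" where
  "spine i = (tower ^^ i) 0"

lemma spine_Suc: "spine (Suc i) = tower (spine i)"
  by (simp add: spine_def)

lemma spine_0 [simp]: "spine 0 = 0"
  by (simp add: spine_def)

lemma spine_1: "spine (Suc 0) = 1"
  by (simp add: spine_Suc)

lemma spine_2: "spine 2 = 2"
  by (simp add: numeral_2_eq_2 spine_Suc)

lemma strict_mono_spine: "strict_mono spine"
  by (simp add: strict_mono_Suc_iff spine_Suc less_tower)

lemma spine_less_iff [simp]: "spine i < spine j \<longleftrightarrow> i < j"
  by (simp add: strict_mono_less strict_mono_spine)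

lemma spine_le_iff [simp]: "spine i \<le> spine j \<longleftrightarrow> i \<le> j"
  by (simp add: strict_mono_less_eq strict_mono_spine)

lemma spine_eq_iff [simp]: "spine i = spine j \<longleftrightarrow> i = j"
  by (simp add: strict_mono_eq strict_mono_spine)

lemma le_spine: "i \<le> spine i"
  by (simp add: strict_mono_imp_increasing strict_mono_spine)

lemma log_sharp_spine_le: "log_sharp (spine i) \<le> i"
proof (induction i)
  case (Suc i)
  have "log_star (spine (Suc i)) \<le> spine i"
    by (simp add: log_star_le_iff spine_Suc)
  then have "log_sharp (log_star (spine (Suc i))) \<le> i"
    using Suc log_sharp_mono le_trans by blast
  then show ?case by (simp add: log_sharp.simps[of "spine (Suc i)"])
qed (simp add: log_sharp.simps)

text \<open>A spine degree is a difference of consecutive values, not a value itself. The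
  subtraction is harmless: with \<open>x = spine (Suc i) = Suc y\<close>, the bounds
  \<open>2 * tower y \<le> tower x\<close> and \<open>x \<le> tower y\<close> leave
  \<open>tower x - x\<close> at least \<open>tower y\<close>.\<close>

lemma spine_gap:
  assumes "spine (Suc (Suc i)) - spine (Suc i) < d"
  shows "spine (Suc i) \<le> log_star d"
proof (rule ccontr)
  define x where "x = spine (Suc i)"
  have "x > 0" using spine_less_iff[of 0 "Suc i"] by (simp add: x_def)
  then obtain y where y: "x = Suc y" using gr0_conv_Suc by blast
  assume "\<not> spine (Suc i) \<le> log_star d"
  then have "d \<le> tower y" using y by (simp add: x_def flip: log_star_le_iff)
  moreover have "tower x - x < d"
    using assms by (simp add: x_def spine_Suc)
  moreover have "x \<le> tower y" using less_tower[of y] y by simp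
  moreover have "2 * tower y \<le> 2 ^ tower y" by (rule double_le_power)
  ultimately show False using y by simp
qed


section \<open>The problem\<close>

definition lower :: "nat \<Rightarrow> nat \<Rightarrow> bool" where
  "lower d d' \<longleftrightarrow> 3 \<le> d' \<and> d' \<le> log_star d"

definition ball_degree :: "labeled_ball \<Rightarrow> nat \<Rightarrow> nat" where
  "ball_degree b u = card {w \<in> ball_nodes b. (u, w) \<in> ball_edges b}"

definition center_candidate :: "labeled_ball \<Rightarrow> nat \<Rightarrow> bool" where
  "center_candidate b c \<longleftrightarrow> c \<in> ball_nodes b \<and>
     (\<forall>w\<in>ball_nodes b. c = w \<or> (c, w) \<in> ball_edges b \<or>
        (\<exists>x\<in>ball_nodes b. (c, x) \<in> ball_edges b \<and> (x, w) \<in> ball_edges b))"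

definition rule_at :: "labeled_ball \<Rightarrow> nat \<Rightarrow> bool" where
  "rule_at b c \<longleftrightarrow>
     (snd (ball_label b c) = 1 \<longleftrightarrow> fst (ball_label b c) = 1 \<or>
        (\<exists>u\<in>ball_nodes b. (c, u) \<in> ball_edges b \<and>
           lower (ball_degree b c) (ball_degree b u) \<and> snd (ball_label b u) = 1))"

text \<open>
  The predicate must not mention \<^const>\<open>ball_center\<close>: \<^const>\<open>ball_isomorphic\<close> also relates a
  ball whose center lies outside its node set to the same ball with any of its nodes as
  center, so invariance forces independence of the center. The rule is therefore required at
  some node that could be the center; on the hard instances there is only one.
\<close>

definition descent_problem :: problem where
  "descent_problem =
     \<lparr>in_labels = {0, 1}, out_labels = {0, 1}, radius = 2,
      accepts = (\<lambda>b. \<exists>c. center_candidate b c \<and> rule_at b c)\<rparr>"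

lemma descent_problem_simps [simp]:
  "in_labels descent_problem = {0, 1}" "out_labels descent_problem = {0, 1}"
  "radius descent_problem = 2"
  "accepts descent_problem b \<longleftrightarrow> (\<exists>c. center_candidate b c \<and> rule_at b c)"
  by (simp_all add: descent_problem_def)

section \<open>Invariance of the predicate under isomorphisms of balls\<close>

context
  fixes b b' :: labeled_ball and f :: "nat \<Rightarrow> nat"
  assumes bij: "bij_betw f (ball_nodes b) (ball_nodes b')"
    and edge: "\<And>u w. u \<in> ball_nodes b \<Longrightarrow> w \<in> ball_nodes b \<Longrightarrow>
      (u, w) \<in> ball_edges b \<longleftrightarrow> (f u, f w) \<in> ball_edges b'"
    and label: "\<And>u. u \<in> ball_nodes b \<Longrightarrow> ball_label b u = ball_label b' (f u)"
begin

lemma nodes_image: "ball_nodes b' = f ` ball_nodes b"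
  using bij by (simp add: bij_betw_def)

lemma ball_degree_iso:
  assumes "u \<in> ball_nodes b"
  shows "ball_degree b' (f u) = ball_degree b u"
proof -
  have "{w \<in> ball_nodes b'. (f u, w) \<in> ball_edges b'} =
      f ` {w \<in> ball_nodes b. (u, w) \<in> ball_edges b}"
    using assms edge by (auto simp: nodes_image)
  moreover have "inj_on f {w \<in> ball_nodes b. (u, w) \<in> ball_edges b}"
    using bij by (auto simp: bij_betw_def inj_on_def)
  ultimately show ?thesis by (simp add: ball_degree_def card_image)
qed

lemma center_candidate_iso:
  assumes "c \<in> ball_nodes b"
  shows "center_candidate b' (f c) \<longleftrightarrow> center_candidate b c"
proof -
  have inj: "f c = f w \<longleftrightarrow> c = w" if "w \<in> ball_nodes b" for w
    using bij assms that by (auto simp: bij_betw_def inj_on_def)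
  have "(f c, f w) \<in> ball_edges b' \<longleftrightarrow> (c, w) \<in> ball_edges b" if "w \<in> ball_nodes b" for w
    using edge[OF assms that] by simp
  then show ?thesis
    using assms inj by (simp add: center_candidate_def nodes_image edge cong: ball_cong bex_cong)
qed

lemma rule_at_iso:
  assumes "c \<in> ball_nodes b"
  shows "rule_at b' (f c) \<longleftrightarrow> rule_at b c"
proof -
  have "(f c, f w) \<in> ball_edges b' \<longleftrightarrow> (c, w) \<in> ball_edges b" if "w \<in> ball_nodes b" for w
    using edge[OF assms that] by simp
  then show ?thesis
    using assms
    by (simp add: rule_at_def nodes_image ball_degree_iso label cong: bex_cong)
qed

lemma accepts_iso: "accepts descent_problem b \<longleftrightarrow> accepts descent_problem b'"
proof -
  \<comment> \<open>The transport lemmas apply only to nodes of the ball. Candidates of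
    \<open>b'\<close> are pulled back through the surjectivity of \<open>f\<close>.\<close>
  have "c \<in> ball_nodes b" if "center_candidate b c" for b c
    using that by (simp add: center_candidate_def)
  then show ?thesis
    using center_candidate_iso rule_at_iso nodes_image
    by simp (metis imageE imageI)
qed

end

lemma locally_checkable_descent_problem: "locally_checkable descent_problem"
  unfolding locally_checkable_def ball_isomorphic_def
proof (intro conjI allI impI; (elim exE conjE)?)
  show "accepts descent_problem b = accepts descent_problem b'"
    if "bij_betw f (ball_nodes b) (ball_nodes b')"
      "\<forall>u\<in>ball_nodes b. \<forall>w\<in>ball_nodes b. ((u, w) \<in> ball_edges b) = ((f u, f w) \<in> ball_edges b')"
      "\<forall>u\<in>ball_nodes b. ball_label b u = ball_label b' (f u)" for b b' f
    using accepts_iso[of f b b'] that by blast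
qed simp_all

section \<open>Balls of radius 2 inside a graph\<close>

lemma ball_around_2:
  "u \<in> ball_around E 2 v \<longleftrightarrow> v = u \<or> (v, u) \<in> E \<or> (\<exists>x. (v, x) \<in> E \<and> (x, u) \<in> E)"
proof -
  have "(\<exists>k\<le>2. (v, u) \<in> E ^^ k) \<longleftrightarrow> (v, u) \<in> E ^^ 0 \<or> (v, u) \<in> E ^^ 1 \<or> (v, u) \<in> E ^^ 2"
    unfolding numeral_2_eq_2 by (auto simp: le_Suc_eq simp del: relpow.simps)
  then show ?thesis by (auto simp: ball_around_def numeral_2_eq_2)
qed

text \<open>Hence a labeling that obeys the rule at every true center is accepted, which is what the
  upper bound needs.\<close>

lemma center_candidate_center: "center_candidate (labeled_ball_around E l 2 v) v"
  unfolding center_candidate_def labeled_ball_around_def by (auto simp: ball_around_2)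

text \<open>This is the reason for radius 2: all neighbors of a neighbor of the center still lie in
  the ball, so no degree that the rule inspects is truncated.\<close>

lemma ball_degree_around:
  assumes "u = v \<or> (v, u) \<in> E"
  shows "ball_degree (labeled_ball_around E l 2 v) u = card {w. (u, w) \<in> E}"
proof -
  have "{w \<in> ball_around E 2 v. (u, w) \<in> Restr E (ball_around E 2 v)} = {w. (u, w) \<in> E}"
    using assms by (auto simp: ball_around_2)
  then show ?thesis by (simp add: ball_degree_def labeled_ball_around_def)
qed

lemma rule_at_center:
  "rule_at (labeled_ball_around E l 2 v) v \<longleftrightarrow>
     (snd (l v) = 1 \<longleftrightarrow> fst (l v) = 1 \<or>
        (\<exists>u. (v, u) \<in> E \<and> lower (card {w. (v, w) \<in> E}) (card {w. (u, w) \<in> E}) \<and> snd (l u) = 1))"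
proof -
  have "(u \<in> ball_around E 2 v \<and> (v, u) \<in> Restr E (ball_around E 2 v)) \<longleftrightarrow> (v, u) \<in> E" for u
    by (auto simp: ball_around_2)
  then have "(\<exists>u\<in>ball_nodes (labeled_ball_around E l 2 v).
        (v, u) \<in> ball_edges (labeled_ball_around E l 2 v) \<and> Q u) \<longleftrightarrow> (\<exists>u. (v, u) \<in> E \<and> Q u)" for Q
    unfolding labeled_ball_around_def by simp blast
  moreover have "ball_label (labeled_ball_around E l 2 v) = l"
    by (simp add: labeled_ball_around_def)
  ultimately show ?thesis
    by (auto simp: rule_at_def ball_degree_around)
qed


section \<open>The upper bound\<close>

abbreviation degree :: "network \<Rightarrow> nat \<Rightarrow> nat" where
  "degree I v \<equiv> length (ports I ! v)"

lemma edges_iff: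
  "(v, u) \<in> edges I \<longleftrightarrow> v < num_nodes I \<and> u \<in> set (ports I ! v)"
  by (simp add: edges_def)

lemma
  assumes "I \<in> networks R Lin n"
  shows edge_less: "(v, u) \<in> edges I \<Longrightarrow> v < n \<and> u < n"
    and card_neighbors: "v < n \<Longrightarrow> card {w. (v, w) \<in> edges I} = degree I v"
    and degree_le: "v < n \<Longrightarrow> degree I v \<le> n"
proof -
  show less: "v < n \<and> u < n" if "(v, u) \<in> edges I" for v u
    using assms that by (auto simp: networks_def simple_connected_graph_def)
  assume v: "v < n"
  have nb: "{w. (v, w) \<in> edges I} = set (ports I ! v)"
    using assms v by (auto simp: edges_iff networks_def)
  show card: "card {w. (v, w) \<in> edges I} = degree I v"
    using assms v unfolding nb by (simp add: networks_def distinct_card)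
  have "{w. (v, w) \<in> edges I} \<subseteq> {..<n}"
    using less by auto
  then show "degree I v \<le> n"
    using card_mono[of "{..<n}" "{w. (v, w) \<in> edges I}"] card by simp
qed

text \<open>Some descending chain of at most \<open>t\<close> steps leads from \<open>v\<close> to a
  node with input 1. This is the bit that the algorithm holds after \<open>t\<close> rounds.\<close>

primrec reached :: "network \<Rightarrow> nat \<Rightarrow> nat \<Rightarrow> bool" where
  "reached I 0 v \<longleftrightarrow> inputs I ! v = 1"
| "reached I (Suc t) v \<longleftrightarrow> inputs I ! v = 1 \<or>
     (\<exists>u\<in>set (ports I ! v). lower (degree I v) (degree I u) \<and> reached I t u)"

text \<open>Passing to a lower neighbor costs at least one \<open>log_star\<close>, hence one unit
  of \<open>log_sharp\<close>; this bounds the length of descending chains. The decrease of the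
  degree itself supports well-founded induction.\<close>

lemma log_sharp_lower:
  assumes "lower d d'"
  shows "log_sharp d' < log_sharp d" "d' < d"
proof -
  have d': "3 \<le> d'" "d' \<le> log_star d" using assms by (auto simp: lower_def)
  have d: "d > 1"
  proof (rule ccontr)
    assume "\<not> d > 1"
    then have "log_star d \<le> 0" by (subst log_star_le_iff) simp
    with d' show False by simp
  qed
  then have "log_star d < d" by (rule log_star_less)
  with d' show "d' < d" by simp
  have "log_sharp d' \<le> log_sharp (log_star d)" using d' by (intro log_sharp_mono)
  then show "log_sharp d' < log_sharp d" using d by (simp add: log_sharp.simps[of d])
qed

text \<open>The right-hand side does not mention \<open>t\<close>, so the statement gives stability
  from round \<open>log_sharp (degree I v)\<close> on and, at the same time, the equation that the
  rule demands of the final outputs.\<close>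

lemma reached_stable:
  assumes "log_sharp (degree I v) \<le> t"
  shows "reached I t v \<longleftrightarrow> inputs I ! v = 1 \<or>
    (\<exists>u\<in>set (ports I ! v). lower (degree I v) (degree I u) \<and>
       reached I (log_sharp (degree I u)) u)"
  using assms
proof (induction "degree I v" arbitrary: v t rule: less_induct)
  case less
  \<comment> \<open>Two instances of the induction hypothesis share their right-hand side, so their
    left-hand sides agree.\<close>
  have stable: "reached I s u \<longleftrightarrow> reached I (log_sharp (degree I u)) u"
    if "lower (degree I v) (degree I u)" "log_sharp (degree I u) \<le> s" for u s
    using less.hyps[of u s] less.hyps[of u "log_sharp (degree I u)"] that log_sharp_lower(2)
    by blast
  show ?case
  proof (cases t)
    case 0
    then show ?thesis using less.prems log_sharp_lower(1) by fastforce
  next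
    case (Suc s)
    have "log_sharp (degree I u) \<le> s" if "lower (degree I v) (degree I u)" for u
      using log_sharp_lower(1)[OF that] less.prems Suc by simp
    then show ?thesis using stable Suc by auto
  qed
qed

text \<open>The state encodes round counter, degree, input bit and current bit as one number, since
  \<open>algorithm\<close> fixes states and messages to naturals. Messages carry the degree because
  a node does not know the degrees of its neighbors.\<close>

definition descent_algorithm :: algorithm where
  "descent_algorithm =
     \<lparr>init = (\<lambda>N i d x. to_nat (0 :: nat, d, x = 1, x = 1)),
      send = (\<lambda>s i. case from_nat s of (t :: nat, d :: nat, x :: bool, c :: bool) \<Rightarrow> to_nat (d, c)),
      receive = (\<lambda>s ms. case from_nat s of (t :: nat, d, x, c :: bool) \<Rightarrow>
        to_nat (Suc t, d, x,
          x \<or> (\<exists>m\<in>set ms. case from_nat m of (d', c') \<Rightarrow> lower d d' \<and> c'))),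
      announce = (\<lambda>s. case from_nat s of (t, d, x :: bool, c) \<Rightarrow>
        if log_sharp d \<le> t then Some (of_bool c) else None)\<rparr>"

lemma node_state_descent:
  "node_state descent_algorithm I t v = to_nat (t, degree I v, inputs I ! v = 1, reached I t v)"
  by (induction t arbitrary: v) (auto simp: descent_algorithm_def)

lemma announce_descent:
  "announce descent_algorithm (node_state descent_algorithm I t v) =
     (if log_sharp (degree I v) \<le> t then Some (of_bool (reached I t v)) else None)"
  unfolding node_state_descent by (simp add: descent_algorithm_def)

lemma has_output_by_descent:
  "has_output_by descent_algorithm I t v \<longleftrightarrow> log_sharp (degree I v) \<le> t"
  unfolding has_output_by_def announce_descent by auto

lemma final_output_descent:
  "final_output descent_algorithm I v = of_bool (reached I (log_sharp (degree I v)) v)"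
proof -
  have "(LEAST s. announce descent_algorithm (node_state descent_algorithm I s v) \<noteq> None) =
      log_sharp (degree I v)"
    unfolding announce_descent by (rule Least_equality) (auto split: if_splits)
  then show ?thesis by (simp add: final_output_def announce_descent)
qed

lemma solves_descent: "solves descent_algorithm descent_problem R"
  unfolding solves_def
proof (intro allI ballI impI conjI)
  fix n I assume "I \<in> networks R (in_labels descent_problem) n"
  then have I: "I \<in> networks R {0, 1} n" by simp
  then have n: "num_nodes I = n" by (simp add: networks_def)
  show "terminates descent_algorithm I"
    unfolding terminates_def has_output_by_descent n
    using degree_le[OF I] log_sharp_mono by blast
  fix v assume v: "v < n"
  show "final_output descent_algorithm I v \<in> out_labels descent_problem"
    by (simp add: final_output_descent)
  let ?l = "\<lambda>u. (inputs I ! u, final_output descent_algorithm I u)"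
  have "u \<in> set (ports I ! v) \<longleftrightarrow> (v, u) \<in> edges I" for u
    using v n by (simp add: edges_iff)
  \<comment> \<open>At \<open>t = log_sharp (degree I v)\<close>, \<open>reached_stable\<close> is
    the rule at the center, once lengths of port lists are identified with numbers of
    neighbors.\<close>
  then have "rule_at (labeled_ball_around (edges I) ?l 2 v) v"
    using reached_stable[of I v "log_sharp (degree I v)"]
      card_neighbors[OF I] edge_less[OF I]
    by (auto simp: rule_at_center final_output_descent)
  then show "accepts descent_problem
      (labeled_ball_around (edges I) ?l (radius descent_problem) v)"
    using center_candidate_center by auto
qed

text \<open>Nonemptiness gives \<open>Max\<close> its meaning; the caterpillars defined below supply
  it.\<close>

lemma round_complexity_descent_le:
  assumes "polynomial_bounds R" "n \<ge> 1" "networks R {0, 1} n \<noteq> {}"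
  shows "round_complexity descent_algorithm descent_problem R n \<le> log_sharp n"
proof -
  have "rounds descent_algorithm I \<le> log_sharp n" if I: "I \<in> networks R {0, 1} n" for I
    unfolding rounds_def has_output_by_descent
    using I degree_le[OF I] by (intro Least_le) (auto simp: networks_def intro: log_sharp_mono)
  then show ?thesis
    using finite_networks[OF assms(1) _ assms(2), of "{0, 1}"] assms(3)
    by (auto simp: round_complexity_def)
qed


section \<open>The lower bound\<close>

text \<open>An infinite tree on the naturals: the parent of \<open>v > 0\<close> is the largest
  spine number below \<open>v\<close>. The networks used are its restrictions to initial
  segments.\<close>

definition adjacent :: "nat \<Rightarrow> nat \<Rightarrow> bool" where
  "adjacent u v \<longleftrightarrow> (\<exists>i. u = spine i \<and> spine i < v \<and> v \<le> spine (Suc i) \<or>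
     v = spine i \<and> spine i < u \<and> u \<le> spine (Suc i))"

text \<open>The distance from the root 0 in this tree.\<close>

definition depth :: "nat \<Rightarrow> nat" where
  "depth v = (LEAST i. v \<le> spine i)"

lemma depth_eqI: "spine i < v \<Longrightarrow> v \<le> spine (Suc i) \<Longrightarrow> depth v = Suc i"
  unfolding depth_def
  by (rule Least_equality) (auto, metis le_trans not_less not_less_eq_eq spine_le_iff)

lemma depth_spine [simp]: "depth (spine i) = i"
  unfolding depth_def by (rule Least_equality) auto

lemma spine_interval_unique:
  "spine i < v \<Longrightarrow> v \<le> spine (Suc i) \<Longrightarrow> spine j < v \<Longrightarrow> v \<le> spine (Suc j) \<Longrightarrow> i = j"
  by (metis depth_eqI Suc_inject)

lemma parent_exists:
  assumes "v > 0"
  obtains i where "spine i < v" "v \<le> spine (Suc i)"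
proof -
  have le: "v \<le> spine (depth v)"
    unfolding depth_def using le_spine by (rule LeastI)
  then obtain i where i: "depth v = Suc i"
    using assms by (cases "depth v") auto
  then have "\<not> v \<le> spine i"
    unfolding depth_def using not_less_Least[of i "\<lambda>i. v \<le> spine i"] by simp
  then show ?thesis using that[of i] le i by simp
qed

lemma adjacent_sym: "adjacent u v \<longleftrightarrow> adjacent v u"
  by (auto simp: adjacent_def)

lemma adjacent_depth:
  assumes "adjacent u v"
  shows "depth v = Suc (depth u) \<and> u = spine (depth u) \<or>
    depth u = Suc (depth v) \<and> v = spine (depth v)"
  using assms by (auto simp: adjacent_def depth_eqI)

lemma adjacent_spine_Suc_iff:
  "adjacent (spine (Suc i)) v \<longleftrightarrow> v = spine i \<or> spine (Suc i) < v \<and> v \<le> spine (Suc (Suc i))"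
proof -
  have "j = i" if "spine j < spine (Suc i)" "spine (Suc i) \<le> spine (Suc j)" for j
    using that by simp
  then show ?thesis by (auto simp: adjacent_def)
qed

lemma adjacent_nonspine:
  assumes "v \<notin> range spine" "spine i < v" "v \<le> spine (Suc i)"
  shows "adjacent v u \<longleftrightarrow> u = spine i"
  using assms spine_interval_unique by (auto simp: adjacent_def)

text \<open>The input bit sits at node 2, which is \<open>spine 2\<close>, the low end of the chain.
  For \<open>n \<le> 2\<close> the list update has no effect.\<close>

definition caterpillar :: "nat \<Rightarrow> nat \<Rightarrow> nat \<Rightarrow> network" where
  "caterpillar n N x =
     \<lparr>ports = map (\<lambda>v. filter (adjacent v) [0..<n]) [0..<n],
      id_bound = N, idents = [0..<n], inputs = (replicate n 0)[2 := x]\<rparr>"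

lemma caterpillar_simps [simp]:
  "num_nodes (caterpillar n N x) = n"
  "v < n \<Longrightarrow> ports (caterpillar n N x) ! v = filter (adjacent v) [0..<n]"
  "id_bound (caterpillar n N x) = N"
  "idents (caterpillar n N x) = [0..<n]"
  "inputs (caterpillar n N x) = (replicate n 0)[2 := x]"
  by (simp_all add: caterpillar_def num_nodes_def)

lemma edges_caterpillar:
  "(u, v) \<in> edges (caterpillar n N x) \<longleftrightarrow> u < n \<and> v < n \<and> adjacent u v"
  by (auto simp: edges_iff)

lemma caterpillar_network:
  assumes "n \<ge> 1" "N \<in> R n" "n \<le> N" "x \<in> {0, 1}"
  shows "caterpillar n N x \<in> networks R {0, 1} n"
proof -
  let ?E = "edges (caterpillar n N x)"
  have sym: "sym ?E" by (auto simp: sym_def edges_caterpillar adjacent_sym)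
  have to_0: "(v, 0) \<in> ?E\<^sup>*" if "v < n" for v
    using that
  proof (induction v rule: less_induct)
    case (less v)
    show ?case
    proof (cases "v = 0")
      case False
      then obtain i where i: "spine i < v" "v \<le> spine (Suc i)"
        using parent_exists by blast
      then have "(v, spine i) \<in> ?E"
        using less.prems by (auto simp: edges_caterpillar adjacent_def)
      moreover have "(spine i, 0) \<in> ?E\<^sup>*" using less i by simp
      ultimately show ?thesis by (rule converse_rtrancl_into_rtrancl)
    qed simp
  qed
  have "(u, v) \<in> ?E\<^sup>*" if "u < n" "v < n" for u v
    using to_0[OF that(1)] symD[OF sym_rtrancl[OF sym] to_0[OF that(2)]] by (rule rtrancl_trans)
  moreover have "irrefl ?E" by (auto simp: irrefl_def edges_caterpillar adjacent_def)
  ultimately have "simple_connected_graph {..<n} ?E"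
    using assms(1) sym
    by (auto simp: simple_connected_graph_def edges_caterpillar simp flip: atLeast0LessThan)
  moreover have "set ((replicate n 0)[2 := x]) \<subseteq> {0, 1}"
    using set_update_subset_insert[of "replicate n 0" 2 x] assms(4)
    by (auto simp: set_replicate_conv_if split: if_splits)
  ultimately show ?thesis
    using assms by (auto simp: networks_def)
qed

section \<open>Degrees in the caterpillar and the descending chain\<close>

abbreviation cdegree :: "nat \<Rightarrow> nat \<Rightarrow> nat" where
  "cdegree n u \<equiv> card {w. u < n \<and> w < n \<and> adjacent u w}"

lemma cdegree_spine:
  assumes "spine (Suc (Suc i)) < n"
  shows "cdegree n (spine (Suc i)) = Suc (spine (Suc (Suc i)) - spine (Suc i))"
proof -
  have i: "spine i < n" "spine (Suc i) < n"
    using assms spine_less_iff[of i "Suc (Suc i)"] spine_less_iff[of "Suc i" "Suc (Suc i)"]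
    by linarith+
  have "{w. spine (Suc i) < n \<and> w < n \<and> adjacent (spine (Suc i)) w} =
      insert (spine i) {spine (Suc i)<..spine (Suc (Suc i))}"
    using assms i unfolding adjacent_spine_Suc_iff by auto
  then show ?thesis by simp
qed

lemma cdegree_spine_le:
  assumes "spine (Suc (Suc i)) < n"
  shows "cdegree n (spine (Suc i)) \<le> spine (Suc (Suc i))"
proof -
  have "0 < spine (Suc i)" "spine (Suc i) < spine (Suc (Suc i))"
    using spine_less_iff[of 0 "Suc i"] by simp_all
  then show ?thesis using cdegree_spine[OF assms] by linarith
qed

lemma cdegree_nonspine:
  assumes "v \<notin> range spine"
  shows "cdegree n v \<le> 1"
proof -
  have "v > 0" using assms spine_0 by (metis gr0I rangeI)
  then obtain i where "spine i < v" "v \<le> spine (Suc i)" using parent_exists by blast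
  then have "{w. v < n \<and> w < n \<and> adjacent v w} \<subseteq> {spine i}"
    using adjacent_nonspine[OF assms] by auto
  then show ?thesis using card_mono[of "{spine i}"] by fastforce
qed

text \<open>The degree of the farther node exceeds the gap between \<open>spine (i + 2)\<close> and
  \<open>spine (i + 3)\<close>, so by \<open>spine_gap\<close> its \<open>log_star\<close> is at
  least \<open>spine (i + 2)\<close>, which bounds the degree of the nearer node.\<close>

lemma lower_spine:
  assumes "spine (Suc (Suc (Suc i))) < n" "i > 0"
  shows "lower (cdegree n (spine (Suc (Suc i)))) (cdegree n (spine (Suc i)))"
proof -
  have less: "spine (Suc (Suc i)) < n"
    using assms spine_less_iff[of "Suc (Suc i)" "Suc (Suc (Suc i))"] by linarith
  have "cdegree n (spine (Suc i)) \<le> log_star (cdegree n (spine (Suc (Suc i))))"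
    using cdegree_spine_le[OF less] spine_gap[of "Suc i"] cdegree_spine[OF assms(1)]
    by (metis le_trans lessI)
  moreover have "3 \<le> cdegree n (spine (Suc i))"
  proof -
    define x where "x = spine i"
    have "spine 1 \<le> x" using assms(2) by (simp add: x_def)
    then have x: "x \<ge> 1" by (simp add: spine_1)
    have "2 * tower x \<le> tower (Suc x)" by (simp add: double_le_power)
    also have "Suc x \<le> tower x" using less_tower[of x] by simp
    \<comment> \<open>Monotonicity of \<open>tower\<close>, read off the Galois connection.\<close>
    then have "tower (Suc x) \<le> tower (tower x)"
      by (meson log_star_le_iff le_trans order_refl)
    finally show ?thesis
      using less_tower[of x] x cdegree_spine[OF less] by (simp add: spine_Suc x_def)
  qed
  ultimately show ?thesis by (simp add: lower_def)
qed

text \<open>The chain starts at \<open>spine 2\<close>, since \<open>spine 1\<close> has degree 2,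
  below the threshold 3. The bound with \<open>i + 4\<close> ensures that
  \<open>spine (i + 3)\<close> too has all its children.\<close>

lemma lower_neighbor_spine_iff:
  assumes "spine (i + 4) < n"
  shows "adjacent (spine (i + 2)) u \<and> u < n \<and>
      lower (cdegree n (spine (i + 2))) (cdegree n u) \<longleftrightarrow> u = spine (i + 1) \<and> i > 0"
proof -
  have n: "spine (Suc (Suc (Suc i))) < n" "spine (Suc (Suc i)) < n" "spine (Suc i) < n"
    by (rule le_less_trans[OF _ assms], simp)+
  have "\<not> lower (cdegree n (spine (i + 2))) (cdegree n (spine (i + 1)))" if "i = 0"
  proof -
    have "cdegree n (spine (i + 1)) = 2"
      using n that cdegree_spine[of i n] by (simp add: spine_Suc)
    then show ?thesis by (simp add: lower_def)
  qed
  moreover have "\<not> lower (cdegree n (spine (i + 2))) (cdegree n u)"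
    if u: "spine (i + 2) < u" "u \<le> spine (i + 3)"
  proof (cases "u \<in> range spine")
    case True
    then obtain j where "u = spine j" by blast
    with u have "u = spine (i + 3)" by simp
    \<comment> \<open>The relation holds in the opposite direction and strictly decreases degrees,
      so it cannot hold both ways.\<close>
    moreover have "lower (cdegree n (spine (i + 3))) (cdegree n (spine (i + 2)))"
      using lower_spine[of "Suc i" n] assms by (simp add: numeral_eq_Suc)
    ultimately show ?thesis using log_sharp_lower(2) by (meson not_less_iff_gr_or_eq)
  next
    case False
    then show ?thesis using cdegree_nonspine[of u n] by (simp add: lower_def)
  qed
  moreover have "lower (cdegree n (spine (i + 2))) (cdegree n (spine (i + 1)))" if "i > 0"
    using lower_spine[of i n] n that by simp
  moreover have "adjacent (spine (i + 2)) u \<longleftrightarrow>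
      u = spine (i + 1) \<or> spine (i + 2) < u \<and> u \<le> spine (i + 3)"
    using adjacent_spine_Suc_iff[of "Suc i" u] by (simp add: numeral_eq_Suc)
  moreover have "spine (i + 1) < n" using n by simp
  ultimately show ?thesis by blast
qed

text \<open>The ball contains \<open>spine i\<close> at depth \<open>i\<close> and a child
  \<open>d\<close> of \<open>spine (i + 3)\<close> at depth \<open>i + 4\<close>. A node within
  distance 2 of both has depth \<open>i + 2\<close> and is the parent of a node, hence is the spine
  node of that depth.\<close>

lemma center_candidate_unique:
  assumes n: "spine (i + 4) < n"
    and c: "center_candidate
      (labeled_ball_around (edges (caterpillar n N x)) l 2 (spine (i + 2))) c"
  shows "c = spine (i + 2)"
proof -
  define d where "d = Suc (spine (i + 3))"
  let ?E = "edges (caterpillar n N x)"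
  have n': "spine j < n" if "j \<le> i + 4" for j
    using n spine_le_iff[of j "i + 4"] that by linarith
  have d: "spine (i + 3) < d" "d \<le> spine (Suc (i + 3))"
    using spine_less_iff[of "i + 3" "Suc (i + 3)"] by (simp_all add: d_def del: spine_less_iff)
  then have "d < n" using n'[of "i + 4"] by (simp add: numeral_eq_Suc)
  have depth_d: "depth d = i + 4" using depth_eqI[OF d] by simp
  have adj: "adjacent (spine j) (spine (Suc j))" "adjacent (spine (Suc j)) (spine j)" for j
    by (auto simp: adjacent_def)
  have "adjacent (spine (i + 3)) d" using d by (auto simp: adjacent_def)
  then have "(spine (i + 2), spine (i + 1)) \<in> ?E" "(spine (i + 1), spine i) \<in> ?E"
    "(spine (i + 2), spine (i + 3)) \<in> ?E" "(spine (i + 3), d) \<in> ?E"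
    using n' adj[of i] adj[of "i + 1"] adj[of "i + 2"] \<open>d < n\<close>
    by (simp_all add: edges_caterpillar numeral_eq_Suc)
  then have "spine i \<in> ball_around ?E 2 (spine (i + 2))" "d \<in> ball_around ?E 2 (spine (i + 2))"
    by (auto simp: ball_around_2)
  then have near: "c = w \<or> adjacent c w \<or> (\<exists>y. adjacent c y \<and> adjacent y w)"
    if "w \<in> {spine i, d}" for w
    using c that by (fastforce simp: center_candidate_def labeled_ball_around_def edges_caterpillar)
  have step: "depth u \<le> Suc (depth w)" if "adjacent u w" for u w
    using adjacent_depth[OF that] by auto
  have le: "depth c \<le> i + 2"
    using near[of "spine i"] step[of c] step[of _ "spine i"] by fastforce
  have "depth d \<le> Suc (depth c)" if "adjacent c d"
    using step that adjacent_sym by blast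
  then obtain y where y: "adjacent c y" "adjacent y d"
    using near[of d] le depth_d by auto
  then show ?thesis
    using le adjacent_depth[OF y(1)] adjacent_depth[OF y(2)] depth_d by auto
qed

text \<open>Since the center is the only candidate, the rule truly holds there:
  \<open>spine 2\<close> must output its input, and each later spine node must copy its
  predecessor.\<close>

lemma output_spine:
  fixes A :: algorithm
  assumes A: "solves A descent_problem R" and I: "caterpillar n N x \<in> networks R {0, 1} n"
    and n: "spine (i + 4) < n"
  shows "final_output A (caterpillar n N x) (spine (i + 2)) = 1 \<longleftrightarrow> x = 1"
  using n
proof (induction i)
  let ?I = "caterpillar n N x"
  have rule: "final_output A ?I (spine (i + 2)) = 1 \<longleftrightarrow>
      inputs ?I ! spine (i + 2) = 1 \<or> i > 0 \<and> final_output A ?I (spine (i + 1)) = 1"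
    if n: "spine (i + 4) < n" for i
  proof -
    let ?v = "spine (i + 2)"
    let ?b = "labeled_ball_around (edges ?I) (\<lambda>u. (inputs ?I ! u, final_output A ?I u)) 2 ?v"
    have v: "?v < n" using n spine_less_iff[of "i + 2" "i + 4"] by linarith
    then have "n \<ge> 1" by simp
    with A I v have "accepts descent_problem ?b"
      unfolding solves_def by (metis descent_problem_simps(1,3))
    then have "rule_at ?b ?v" using center_candidate_unique[OF n] by auto
    then have "final_output A ?I ?v = 1 \<longleftrightarrow> inputs ?I ! ?v = 1 \<or>
        (\<exists>u. (adjacent ?v u \<and> u < n \<and> lower (cdegree n ?v) (cdegree n u)) \<and>
          final_output A ?I u = 1)"
      \<comment> \<open>Rewriting edges turns the neighbor counts of \<open>rule_at_center\<close>
        into \<open>cdegree\<close>.\<close>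
      using v by (auto simp: rule_at_center edges_caterpillar)
    then show ?thesis unfolding lower_neighbor_spine_iff[OF n] by auto
  qed
  {
    case 0
    have "2 < n" using 0 spine_less_iff[of 2 4] by (simp add: spine_2)
    then show ?case using rule[OF 0] spine_2 by (simp flip: numeral_2_eq_2)
  next
    case (Suc i)
    have less: "spine (i + 4) < n" "spine (Suc i + 2) < n"
      by (rule le_less_trans[OF _ Suc.prems], simp)+
    have "spine (Suc i + 2) \<noteq> 2" using spine_eq_iff[of "Suc i + 2" 2] by (simp add: spine_2)
    with less have "inputs ?I ! spine (Suc i + 2) = 0" by (simp del: add_2_eq_Suc')
    then show ?case using rule[OF Suc.prems] Suc.IH[OF less(1)] by simp
  }
qed

text \<open>The two instances differ only at depth 2, and information moves by at most one level of
  depth per round.\<close>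

lemma node_state_caterpillar_eq:
  assumes "v < n" "depth v > s + 2"
  shows "node_state A (caterpillar n N x) s v = node_state A (caterpillar n N y) s v"
  using assms
proof (induction s arbitrary: v)
  case 0
  then have "v \<noteq> 2" using depth_spine[of 2] by (auto simp: spine_2)
  with 0 show ?case by simp
next
  case (Suc s)
  have "ports (caterpillar n N x) = ports (caterpillar n N y)"
    by (simp add: caterpillar_def)
  then have "port_to (caterpillar n N x) = port_to (caterpillar n N y)"
    by (simp add: port_to_def fun_eq_iff)
  moreover have "node_state A (caterpillar n N x) s u = node_state A (caterpillar n N y) s u"
    if "u < n" "adjacent v u" for u
    using Suc.IH[OF that(1)] Suc.prems adjacent_depth[OF that(2)] by auto
  ultimately have "map (\<lambda>u. send A (node_state A (caterpillar n N x) s u)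
        (port_to (caterpillar n N x) u v)) (ports (caterpillar n N x) ! v) =
      map (\<lambda>u. send A (node_state A (caterpillar n N y) s u)
        (port_to (caterpillar n N y) u v)) (ports (caterpillar n N y) ! v)"
    using Suc.prems(1) by (intro map_cong) auto
  moreover have "node_state A (caterpillar n N x) s v = node_state A (caterpillar n N y) s v"
    using Suc by simp
  ultimately show ?case by (simp only: node_state.simps)
qed

lemma final_output_cong:
  assumes eq: "\<And>s. s \<le> t \<Longrightarrow> node_state A I s v = node_state A J s v"
    and t: "has_output_by A I t v"
  shows "final_output A I v = final_output A J v"
proof -
  define m where "m = (LEAST s. announce A (node_state A I s v) \<noteq> None)"
  obtain s where s: "s \<le> t" "announce A (node_state A I s v) \<noteq> None"
    using t by (auto simp: has_output_by_def)
  have m: "announce A (node_state A I m v) \<noteq> None" "m \<le> t"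
    using LeastI[of _ s] Least_le[of _ s] s unfolding m_def by (metis (mono_tags, lifting) le_trans)+
  have "(LEAST s. announce A (node_state A J s v) \<noteq> None) = m"
  proof (rule Least_equality)
    show "announce A (node_state A J m v) \<noteq> None" using m eq by simp
    \<comment> \<open>An announcement before round \<open>m\<close> would also occur in
      \<open>I\<close>, where the states agree up to round \<open>t\<close>.\<close>
    show "m \<le> y" if "announce A (node_state A J y v) \<noteq> None" for y
    proof (rule ccontr)
      assume "\<not> m \<le> y"
      then show False
        using not_less_Least[of y "\<lambda>s. announce A (node_state A I s v) \<noteq> None"] m(2) eq[of y] that
        by (simp add: m_def)
    qed
  qed
  then show ?thesis using m eq by (simp add: final_output_def m_def)
qed

text \<open>With fewer than \<open>i\<close> rounds, \<open>spine (i + 2)\<close> cannot distinguish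
  input bit 0 from 1 at node 2, yet its output must equal that bit. Only the run with bit 0 has to
  be short.\<close>

lemma round_complexity_ge:
  fixes A :: algorithm
  assumes R: "polynomial_bounds R" and A: "solves A descent_problem R" and n: "spine (i + 4) < n"
  shows "i \<le> round_complexity A descent_problem R n"
proof (rule ccontr)
  assume less: "\<not> i \<le> round_complexity A descent_problem R n"
  have n1: "n \<ge> 1" using n by simp
  obtain N where N: "N \<in> R n" "n \<le> N" using R n1 unfolding polynomial_bounds_def by blast
  have I: "caterpillar n N x \<in> networks R {0, 1} n" if "x \<in> {0, 1}" for x
    using caterpillar_network[of n N R x] n1 N that by blast
  let ?I = "caterpillar n N 0" and ?J = "caterpillar n N 1" and ?v = "spine (i + 2)"
  have v: "?v < n" using n spine_less_iff[of "i + 2" "i + 4"] by linarith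
  have "rounds A ?I \<le> round_complexity A descent_problem R n"
    unfolding round_complexity_def using finite_networks[OF R _ n1, of "{0, 1}"] I by simp
  with less have r: "rounds A ?I < i" by simp
  have "terminates A ?I" using A I[of 0] n1 by (auto simp: solves_def)
  then have "\<forall>v<num_nodes ?I. has_output_by A ?I (rounds A ?I) v"
    unfolding terminates_def rounds_def by (rule LeastI_ex)
  then have "has_output_by A ?I (rounds A ?I) ?v" using v by simp
  moreover have "node_state A ?I s ?v = node_state A ?J s ?v" if "s \<le> rounds A ?I" for s
    using r that by (intro node_state_caterpillar_eq[OF v]) simp
  ultimately have "final_output A ?I ?v = final_output A ?J ?v"
    using final_output_cong by blast
  then show False
    using output_spine[OF A I[of 0] n] output_spine[OF A I[of 1] n] by simp
qed

theorem theorem17: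
  shows "\<exists>P. locally_checkable P \<and>
    (\<forall>R. polynomial_bounds R \<longrightarrow> has_round_complexity_Theta P R log_sharp)"
proof (intro exI conjI allI impI)
  show "locally_checkable descent_problem" by (rule locally_checkable_descent_problem)
  fix R :: "nat \<Rightarrow> nat set" assume R: "polynomial_bounds R"
  show "has_round_complexity_Theta descent_problem R log_sharp"
    unfolding has_round_complexity_Theta_def
  proof (intro conjI exI allI impI)
    show "solves descent_algorithm descent_problem R" by (rule solves_descent)
    have "round_complexity descent_algorithm descent_problem R n \<le> log_sharp n" if "n \<ge> 1" for n
    proof -
      obtain N where "N \<in> R n" "n \<le> N" using R \<open>n \<ge> 1\<close> unfolding polynomial_bounds_def by blast
      then have "networks R {0, 1} n \<noteq> {}"
        using caterpillar_network[of n N R 0] that by blast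
      then show ?thesis using round_complexity_descent_le[OF R that] by blast
    qed
    then show "(\<lambda>n. real (round_complexity descent_algorithm descent_problem R n))
        \<in> O(\<lambda>n. real (log_sharp n))"
      by (intro bigoI[of _ 1] eventually_sequentiallyI[of 1]) simp
  next
    fix A :: algorithm assume A: "solves A descent_problem R"
    \<comment> \<open>For \<open>n\<close> between consecutive spine values with lower index
      \<open>j = i + 4\<close>, \<open>log_sharp n \<le> i + 5\<close>. This is at most
      \<open>2 * i\<close> once \<open>i \<ge> 5\<close>, that is \<open>j \<ge> 9\<close>; hence
      the threshold \<open>spine 9\<close>.\<close>
    have "log_sharp n \<le> 2 * round_complexity A descent_problem R n" if "Suc (spine 9) \<le> n" for n
    proof -
      have "n > 0" using that by simp
      then obtain j where j: "spine j < n" "n \<le> spine (Suc j)" by (rule parent_exists)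
      with that have "spine 9 < spine (Suc j)" by linarith
      then have "9 \<le> j" by simp
      then obtain i where i: "j = i + 4" "5 \<le> i" using le_Suc_ex[of 9 j] by fastforce
      have "log_sharp n \<le> Suc j"
        using log_sharp_mono[OF j(2)] log_sharp_spine_le le_trans by blast
      then show ?thesis using round_complexity_ge[OF R A, of i n] i j by simp
    qed
    then have "eventually (\<lambda>n. norm (real (round_complexity A descent_problem R n)) \<ge>
        1 / 2 * norm (real (log_sharp n))) at_top"
      by (intro eventually_sequentiallyI[of "Suc (spine 9)"]) fastforce
    then show "(\<lambda>n. real (round_complexity A descent_problem R n)) \<in> \<Omega>(\<lambda>n. real (log_sharp n))"
      by (intro landau_omega.bigI[of "1 / 2"]) auto
  qed
qed

end
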